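(* Any connected paracompact locally small space is Lindelöf.
   Context: A locally small space is a pair $(X,\mathcal{L}_X)$ with $X$ a set and $\mathcal{L}_X\subseteq\mathcal{P}(X)$ such that $\emptyset\in\mathcal{L}_X$, $L\cap M,L\cup M\in\mathcal{L}_X$ for all $L,M\in\mathcal{L}_X$, and $\bigcup\mathcal{L}_X=X$. Its open sets are the members of $\mathcal{L}_X^o=\{V\subseteq X:V\cap L\in\mathcal{L}_X\ \forall L\in\mathcal{L}_X\}$. A family $\mathcal{U}\subseteq\mathcal{L}_X^o$ is locally finite if each member of $\mathcal{L}_X$ has non-empty intersection with only finitely many members of $\mathcal{U}$; it is admissible if for each $L\in\mathcal{L}_X$ there is a finite $\mathcal{U}_L\subseteq\mathcal{U}$ with $(\bigcup\mathcal{U})\cap L=(\bigcup\mathcal{U}_L)\cap L$. The space is: paracompact if there exists a locally finite subfamily of $\mathcal{L}_X$ covering $X$; Lindelöf if there exists a countable admissible subfamily of $\mathcal{L}_X$ covering $X$; connected if $X$ cannot be written as a disjoint union of two non-empty open subsets. *)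

theory Defs
  imports Main "HOL-Library.Countable_Set"
begin

locale locally_small_space =
  fixes X :: "'a set" and \<L> :: "'a set set"
  assumes smops_subset: "\<L> \<subseteq> Pow X"
    and empty_smop: "{} \<in> \<L>"
    and Int_smop: "\<lbrakk>L \<in> \<L>; M \<in> \<L>\<rbrakk> \<Longrightarrow> L \<inter> M \<in> \<L>"
    and Un_smop: "\<lbrakk>L \<in> \<L>; M \<in> \<L>\<rbrakk> \<Longrightarrow> L \<union> M \<in> \<L>"
    and Union_smops: "\<Union>\<L> = X"

text \<open>The following notions take the space \<open>(X, \<L>)\<close> as two explicit arguments; they are
  meant to be used when \<open>locally_small_space X \<L>\<close> holds. Families of sets are sets of sets.\<close>

definition ls_opens :: "'a set \<Rightarrow> 'a set set \<Rightarrow> 'a set set" where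
  "ls_opens X \<L> = {V. V \<subseteq> X \<and> (\<forall>L\<in>\<L>. V \<inter> L \<in> \<L>)}"

definition ls_locally_finite :: "'a set \<Rightarrow> 'a set set \<Rightarrow> 'a set set \<Rightarrow> bool" where
  "ls_locally_finite X \<L> \<U> \<longleftrightarrow>
     \<U> \<subseteq> ls_opens X \<L> \<and> (\<forall>L\<in>\<L>. finite {U \<in> \<U>. L \<inter> U \<noteq> {}})"

definition ls_admissible :: "'a set \<Rightarrow> 'a set set \<Rightarrow> 'a set set \<Rightarrow> bool" where
  "ls_admissible X \<L> \<U> \<longleftrightarrow>
     \<U> \<subseteq> ls_opens X \<L> \<and>
     (\<forall>L\<in>\<L>. \<exists>\<U>\<^sub>L. finite \<U>\<^sub>L \<and> \<U>\<^sub>L \<subseteq> \<U> \<and> \<Union>\<U> \<inter> L = \<Union>\<U>\<^sub>L \<inter> L)"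

definition ls_paracompact :: "'a set \<Rightarrow> 'a set set \<Rightarrow> bool" where
  "ls_paracompact X \<L> \<longleftrightarrow> (\<exists>\<U>. \<U> \<subseteq> \<L> \<and> ls_locally_finite X \<L> \<U> \<and> \<Union>\<U> = X)"

text \<open>As usual, \<^const>\<open>countable\<close> includes the finite families.\<close>

definition ls_Lindelof :: "'a set \<Rightarrow> 'a set set \<Rightarrow> bool" where
  "ls_Lindelof X \<L> \<longleftrightarrow>
     (\<exists>\<U>. \<U> \<subseteq> \<L> \<and> countable \<U> \<and> ls_admissible X \<L> \<U> \<and> \<Union>\<U> = X)"

text \<open>With this definition the empty space counts as connected.\<close>

definition ls_connected :: "'a set \<Rightarrow> 'a set set \<Rightarrow> bool" where
  "ls_connected X \<L> \<longleftrightarrow>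
     \<not> (\<exists>V W. V \<in> ls_opens X \<L> \<and> W \<in> ls_opens X \<L> \<and> V \<noteq> {} \<and> W \<noteq> {} \<and>
            V \<inter> W = {} \<and> X = V \<union> W)"

end

theory Submission
  imports Defs
begin

text \<open>Let \<open>\<U>\<close> be a locally finite cover of \<open>X\<close> by smops (members of \<open>\<L>\<close>). Each smop meets only
  finitely many members of \<open>\<U>\<close>, and the members of \<open>\<U>\<close> are themselves smops, so the graph on
  \<open>\<U>\<close> whose edges join sets that meet is locally finite, and each of its connected components is
  countable. Unions of subfamilies of \<open>\<U>\<close> are open (\<open>locally_finite_Union_open\<close>), hence a component
  \<open>\<C>\<close> and its complement \<open>\<U> - \<C>\<close> split \<open>X\<close> into two disjoint open sets. As \<open>X\<close> is connected, the
  component of a non-empty member exhausts \<open>\<U>\<close> up to the empty set. Thus \<open>\<U>\<close> is countable, and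
  it is admissible because it is locally finite.\<close>

text \<open>Inside a smop only finitely many members of the family are visible, so an arbitrary union
  looks there like a finite union of smops.\<close>

lemma locally_finite_Union_open:
  assumes "locally_small_space X \<L>"
    and lf: "ls_locally_finite X \<L> \<U>" and "\<C> \<subseteq> \<U>"
  shows "\<Union>\<C> \<in> ls_opens X \<L>"
proof -
  interpret locally_small_space X \<L> by fact
  have opens: "\<C> \<subseteq> ls_opens X \<L>"
    using lf \<open>\<C> \<subseteq> \<U>\<close> by (auto simp: ls_locally_finite_def)
  have fin_Union: "\<Union>\<F> \<in> \<L>" if "finite \<F>" "\<F> \<subseteq> \<L>" for \<F>
    using that by induction (auto intro: empty_smop Un_smop)
  have "\<Union>\<C> \<inter> L \<in> \<L>" if L: "L \<in> \<L>" for L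
  proof -
    define \<F> where "\<F> = (\<lambda>U. U \<inter> L) ` {U \<in> \<C>. L \<inter> U \<noteq> {}}"
    have "finite {U \<in> \<U>. L \<inter> U \<noteq> {}}"
      using lf L by (auto simp: ls_locally_finite_def)
    then have "finite \<F>"
      unfolding \<F>_def by (intro finite_imageI, rule rev_finite_subset) (use \<open>\<C> \<subseteq> \<U>\<close> in auto)
    moreover have "\<F> \<subseteq> \<L>"
      using opens L by (auto simp: \<F>_def ls_opens_def)
    moreover have "\<Union>\<C> \<inter> L = \<Union>\<F>"
      by (auto simp: \<F>_def)
    ultimately show ?thesis
      using fin_Union by simp
  qed
  then show ?thesis
    using opens by (auto simp: ls_opens_def)
qed

lemma locally_finite_imp_admissible:
  assumes lf: "ls_locally_finite X \<L> \<U>"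
  shows "ls_admissible X \<L> \<U>"
  unfolding ls_admissible_def
proof (intro conjI ballI)
  show "\<U> \<subseteq> ls_opens X \<L>"
    using lf by (simp add: ls_locally_finite_def)
  fix L assume "L \<in> \<L>"
  then have "finite {U \<in> \<U>. L \<inter> U \<noteq> {}}"
    using lf by (simp add: ls_locally_finite_def)
  moreover have "\<Union>\<U> \<inter> L = \<Union>{U \<in> \<U>. L \<inter> U \<noteq> {}} \<inter> L"
    by auto
  ultimately show "\<exists>\<U>\<^sub>L. finite \<U>\<^sub>L \<and> \<U>\<^sub>L \<subseteq> \<U> \<and> \<Union>\<U> \<inter> L = \<Union>\<U>\<^sub>L \<inter> L"
    by (intro exI[of _ "{U \<in> \<U>. L \<inter> U \<noteq> {}}"]) auto
qed

text \<open>Starting from a non-empty member, countably many members are reached through chains of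
  pairwise meeting neighbours; a non-empty member out of reach would yield a separation of \<open>X\<close>.\<close>

lemma connected_locally_finite_smop_cover_countable:
  assumes space: "locally_small_space X \<L>"
    and conn: "ls_connected X \<L>"
    and smops: "\<U> \<subseteq> \<L>" and lf: "ls_locally_finite X \<L> \<U>" and cover: "\<Union>\<U> = X"
  shows "countable \<U>"
proof (cases "\<U> \<subseteq> {{}}")
  case True
  then show ?thesis
    by (rule countable_subset) simp
next
  case False
  then obtain A where A: "A \<in> \<U>" "A \<noteq> {}"
    by auto
  define meets where "meets = {(U, V). U \<in> \<U> \<and> V \<in> \<U> \<and> U \<inter> V \<noteq> {}}"
  define \<C> where "\<C> = meets\<^sup>* `` {A}"
  have "finite (meets `` {U})" for U
  proof (cases "U \<in> \<U>")
    case True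
    then have "finite {V \<in> \<U>. U \<inter> V \<noteq> {}}"
      using lf smops by (auto simp: ls_locally_finite_def)
    then show ?thesis
      by (rule rev_finite_subset) (auto simp: meets_def)
  qed (auto simp: meets_def)
  then have "countable (meets `` \<V>)" if "countable \<V>" for \<V>
    using that by (subst Image_eq_UN) (auto intro: countable_finite)
  then have "countable \<C>"
    unfolding \<C>_def by (intro countable_rtrancl) auto
  have "U \<in> \<U>" if "(A, U) \<in> meets\<^sup>*" for U
    using that A by induction (auto simp: meets_def)
  then have \<C>_sub: "\<C> \<subseteq> \<U>"
    by (auto simp: \<C>_def)
  have closed: "V \<in> \<C>" if "U \<in> \<C>" "V \<in> \<U>" "U \<inter> V \<noteq> {}" for U V
  proof -
    have "(A, U) \<in> meets\<^sup>*" "(U, V) \<in> meets"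
      using that \<C>_sub by (auto simp: meets_def \<C>_def)
    then have "(A, V) \<in> meets\<^sup>*"
      by (rule rtrancl_into_rtrancl)
    then show ?thesis
      by (simp add: \<C>_def)
  qed
  have "\<Union>\<C> \<inter> \<Union>(\<U> - \<C>) = {}"
    using closed by blast
  moreover have "X = \<Union>\<C> \<union> \<Union>(\<U> - \<C>)"
    using cover \<C>_sub by blast
  moreover have "\<Union>\<C> \<noteq> {}"
    using A by (auto simp: \<C>_def)
  moreover have "\<Union>\<C> \<in> ls_opens X \<L>" "\<Union>(\<U> - \<C>) \<in> ls_opens X \<L>"
    using locally_finite_Union_open[OF space lf] \<C>_sub by blast+
  ultimately have "\<Union>(\<U> - \<C>) = {}"
    using conn unfolding ls_connected_def by blast
  then have "\<U> \<subseteq> insert {} \<C>"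
    by blast
  then show ?thesis
    using \<open>countable \<C>\<close> by (auto intro: countable_subset)
qed

theorem theorem2p57:
  fixes X :: "'a set" and \<L> :: "'a set set"
  assumes "locally_small_space X \<L>"
    and "ls_connected X \<L>"
    and "ls_paracompact X \<L>"
  shows "ls_Lindelof X \<L>"
proof -
  obtain \<U> where \<U>: "\<U> \<subseteq> \<L>" "ls_locally_finite X \<L> \<U>" "\<Union>\<U> = X"
    using assms(3) unfolding ls_paracompact_def by blast
  have "countable \<U>"
    using connected_locally_finite_smop_cover_countable[OF assms(1,2) \<U>] .
  moreover have "ls_admissible X \<L> \<U>"
    using locally_finite_imp_admissible[OF \<U>(2)] .
  ultimately show ?thesis
    unfolding ls_Lindelof_def using \<U>(1,3) by blast
qed

end
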